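(* Let $f$ and $g$ be arithmetical functions that admit absolutely convergent Ramanujan expansions $$f(n)=\sum_{r\ge 1}\hat f(r)\,c_r(n),\qquad g(n)=\sum_{s\ge 1}\hat g(s)\,c_s(n)\qquad (n\ge 1),$$ and suppose there is $\delta>1/2$ such that $|\hat f(r)|\ll r^{-(1+\delta)}$ and $|\hat g(r)|\ll r^{-(1+\delta)}$ for all $r\ge1$. Let $h$ be a positive integer. Then, as $N\to\infty$, $$\sum_{n\le N} f(n)g(n+h)=N\sum_{r\ge 1}\hat f(r)\hat g(r)c_r(h)+O\!\left(N^{\frac{2}{1+2\delta}}(\log N)^{\frac{5+2\delta}{1+2\delta}}\right).$$
   Context: For positive integers $r,n$, the Ramanujan sum is $c_r(n)=\sum_{a\in(\mathbb Z/r\mathbb Z)^*}\zeta_r^{an}$, where $\zeta_r$ is a primitive $r$-th root of unity; equivalently $c_r(n)=\sum_{d\mid \gcd(n,r)}\mu(r/d)\,d$. A Ramanujan expansion of $f$ is a representation $f(n)=\sum_r \hat f(r)c_r(n)$; it is absolutely convergent if the series converges absolutely for every $n$. Implied constants may depend on $f,g,\delta$ and $h$ ($h$ is fixed). *)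

theory Defs
  imports
    "HOL-Analysis.Analysis"
    "HOL-Library.Landau_Symbols"
    "HOL-Number_Theory.Totient"
begin

(* cis (2 * pi / r) is the standard primitive r-th root of unity; totatives r is the set of
   residues a in {1..r} coprime to r, which represents the units modulo r (also for r = 1). *)
definition ramanujan_sum :: "nat \<Rightarrow> nat \<Rightarrow> complex" where
  "ramanujan_sum r n = (\<Sum>a\<in>totatives r. cis (2 * pi / real r) ^ (a * n))"

(* Series over r \<ge> 1 are indexed by Suc r; the values of F and f at 0 play no role. *)
definition ramanujan_expansion :: "(nat \<Rightarrow> complex) \<Rightarrow> (nat \<Rightarrow> complex) \<Rightarrow> bool" where
  "ramanujan_expansion f F \<longleftrightarrow>
     (\<forall>n\<ge>1. (\<lambda>r. F (Suc r) * ramanujan_sum (Suc r) n) sums f n)"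

definition abs_conv_ramanujan_expansion ::
    "(nat \<Rightarrow> complex) \<Rightarrow> (nat \<Rightarrow> complex) \<Rightarrow> bool" where
  "abs_conv_ramanujan_expansion f F \<longleftrightarrow>
     ramanujan_expansion f F \<and>
     (\<forall>n\<ge>1. summable (\<lambda>r. norm (F (Suc r) * ramanujan_sum (Suc r) n)))"

end

theory Submission
  imports Defs
begin

text \<open>
  Inclusion-exclusion gives \<open>c\<^sub>r(n) = \<Sum>d | gcd n r. w(d) d\<close> with \<open>|w(d)| \<le> 1\<close>, so the correlation of
  \<open>c\<^sub>r(n)\<close> and \<open>c\<^sub>s(n + h)\<close> over \<open>n \<le> N\<close> reduces to counting the \<open>n \<le> N\<close> with \<open>d | n\<close> and
  \<open>e | n + h\<close>. The count is \<open>N \<rho> + O(1)\<close> with \<open>\<rho> \<le> h / (d e)\<close>, and it vanishes if \<open>d > N\<close> or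
  \<open>e > N + h\<close>; interpolating between the two, \<open>d e\<close> times the error is
  \<open>O(N\<^bsup>2 - 2\<theta>\<^esup> d\<^sup>\<theta> e\<^sup>\<theta>)\<close> for every \<open>\<theta>\<close> in \<open>[0, 1]\<close>. Summation over a full period \<open>r s\<close>
  identifies the main term as \<open>N c\<^sub>r(h)\<close> for \<open>r = s\<close> and \<open>0\<close> otherwise. For \<open>\<theta> < \<delta>\<close> the errors,
  weighted by \<open>r\<^bsup>-1-\<delta>\<^esup> s\<^bsup>-1-\<delta>\<^esup>\<close>, are summable over all pairs \<open>r, s\<close>, so no truncation of the
  expansions is needed, and \<open>\<theta> = 2\<delta> / (1 + 2\<delta>)\<close> yields the exponent \<open>2 / (1 + 2\<delta>)\<close>.
\<close>


section \<open>Roots of unity and the divisor expansion of Ramanujan sums\<close>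

lemma cis_root_of_unity_power_eq_1_iff:
  assumes "m > 0"
  shows "cis (2 * pi / real m) ^ k = 1 \<longleftrightarrow> m dvd k"
proof -
  have "cis (2 * pi / real m) ^ k = exp (2 * of_real pi * \<i> * of_nat k / of_nat m)"
    by (simp only: Complex.DeMoivre) (simp add: cis_conv_exp mult_ac)
  with complex_root_unity_eq_1[of m k] assms show ?thesis by simp
qed

text \<open>Orthogonality: since \<open>m dvd M\<close>, the geometric sum runs over whole periods,
  so the numerator \<open>1 - ?z ^ M\<close> vanishes unless the ratio itself is 1.\<close>

lemma sum_powers_root_of_unity:
  assumes "m > 0" and "m dvd M"
  shows "(\<Sum>n=1..M. (cis (2 * pi / real m) ^ k) ^ n) = (if m dvd k then of_nat M else 0)"
proof -
  let ?z = "cis (2 * pi / real m) ^ k"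
  have "(\<Sum>n=1..M. ?z ^ n) = (\<Sum>n<M. ?z * ?z ^ n)"
    by (intro sum.reindex_bij_witness[where i = Suc and j = "\<lambda>n. n - 1"])
       (auto simp flip: power_Suc)
  also have "\<dots> = ?z * (if ?z = 1 then of_nat M else (1 - ?z ^ M) / (1 - ?z))"
    by (simp only: sum_gp_strict flip: sum_distrib_left)
  also have "?z ^ M = cis (2 * pi / real m) ^ (k * M)"
    by (simp add: power_mult)
  also have "\<dots> = 1"
    using assms by (subst cis_root_of_unity_power_eq_1_iff) auto
  finally show ?thesis
    using cis_root_of_unity_power_eq_1_iff[OF assms(1), of k] by auto
qed

lemma prod_primes_dvd_iff:
  fixes S :: "nat set"
  assumes "finite S" and "\<And>p. p \<in> S \<Longrightarrow> prime p"
  shows "\<Prod>S dvd a \<longleftrightarrow> (\<forall>p\<in>S. p dvd a)"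
  using assms
proof (induction S rule: finite_induct)
  case (insert p S)
  have "coprime p (\<Prod>S)"
    using insert by (intro prod_coprime_right primes_coprime) auto
  with insert show ?case
    by (auto intro: divides_mult dest: dvd_mult_left dvd_mult_right)
qed simp

lemma prod_prime_factors_subset_dvd:
  fixes r :: nat
  assumes "S \<subseteq> prime_factors r"
  shows "\<Prod>S dvd r"
  using assms finite_subset[OF assms] by (subst prod_primes_dvd_iff) auto

text \<open>Expand the product of 1 - [p | a] over the primes p dividing \<open>r\<close>. This is
  the sum of \<mu>(q) over q | gcd(a, r): a squarefree q is encoded by its set \<open>S\<close> of
  prime factors, and \<open>(- 1) ^ card S\<close> is \<mu>(q).\<close>

lemma coprime_indicator_eq_sum_Pow:
  fixes a r :: nat
  assumes "r > 0"
  shows "(if coprime a r then 1 else 0) =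
    (\<Sum>S\<in>Pow (prime_factors r). (- 1) ^ card S * (if \<Prod>S dvd a then 1 else (0::complex)))"
proof -
  let ?P = "prime_factors r"
  have prod_indicator: "(\<Prod>p\<in>S. - (if p dvd a then 1 else (0::complex))) =
      (- 1) ^ card S * (if \<Prod>S dvd a then 1 else 0)" if "S \<in> Pow ?P" for S
  proof -
    have fin: "finite S" using that finite_subset by blast
    have "\<Prod>S dvd a \<longleftrightarrow> (\<forall>p\<in>S. p dvd a)"
      using fin that by (intro prod_primes_dvd_iff) auto
    moreover have "(\<Prod>p\<in>S. if p dvd a then 1 else (0::complex)) =
        (if \<forall>p\<in>S. p dvd a then 1 else 0)"
      using fin by auto
    ultimately show ?thesis by (simp add: prod_uminus)
  qed
  have "coprime a r \<longleftrightarrow> (\<forall>p\<in>?P. \<not> p dvd a)"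
  proof
    assume "coprime a r"
    thus "\<forall>p\<in>?P. \<not> p dvd a"
      by (auto simp: in_prime_factors_iff dest: coprime_common_divisor)
  next
    assume *: "\<forall>p\<in>?P. \<not> p dvd a"
    show "coprime a r"
    proof (rule ccontr)
      assume "\<not> coprime a r"
      hence "gcd a r \<noteq> 1" by (simp add: coprime_iff_gcd_eq_1)
      then obtain p where "prime p" "p dvd gcd a r" using prime_factor_nat by blast
      with * assms show False by (auto simp: in_prime_factors_iff)
    qed
  qed
  hence "(if coprime a r then 1 else 0) = (\<Prod>p\<in>?P. 1 - (if p dvd a then 1 else (0::complex)))"
    by (auto intro!: prod.neutral)
  also have "\<dots> = (\<Prod>p\<in>?P. - (if p dvd a then 1 else (0::complex)) + 1)"
    by (intro prod.cong) auto
  also have "\<dots> = (\<Sum>S\<in>Pow ?P. \<Prod>p\<in>S. - (if p dvd a then 1 else (0::complex)))"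
    by (subst prod_add) auto
  finally show ?thesis
    using prod_indicator by simp
qed

text \<open>Unique factorization: a prime in \<open>S\<close> divides \<open>\<Prod>T\<close>, hence
  divides some prime in \<open>T\<close> and equals it.\<close>

lemma inj_on_prod_primes:
  assumes "\<And>p. p \<in> P \<Longrightarrow> prime (p::nat)" and "finite P"
  shows "inj_on Prod (Pow P)"
proof (rule inj_onI)
  have sub: "S \<subseteq> T" if ST: "S \<in> Pow P" "T \<in> Pow P" "\<Prod>S = \<Prod>T" for S T
  proof
    fix p assume p: "p \<in> S"
    have "finite S" "finite T" using that assms(2) finite_subset by blast+
    hence "p dvd \<Prod>T" using p that(3) by (metis dvd_prod_eqI)
    then obtain q where "q \<in> T" "p dvd q"
      using \<open>finite T\<close> p ST assms(1) by (subst (asm) prime_dvd_prod_iff) auto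
    thus "p \<in> T" using p that assms by (metis PowD primes_dvd_imp_eq subset_eq)
  qed
  show "S = T" if "S \<in> Pow P" "T \<in> Pow P" "\<Prod>S = \<Prod>T" for S T
    using sub[OF that] sub[OF that(2,1) that(3)[symmetric]] by blast
qed

text \<open>After inclusion-exclusion over the residues, the multiples of
  \<open>q = \<Prod>S\<close> up to \<open>r\<close> contribute a full sum over the m-th roots of
  unity with \<open>m = r div q\<close>, which orthogonality evaluates. This is the formula with
  \<mu>(r/d) d, where d = r/q.\<close>

lemma ramanujan_sum_eq_sum_Pow:
  assumes "r > 0"
  shows "ramanujan_sum r n = (\<Sum>S\<in>Pow (prime_factors r).
    (- 1) ^ card S * (if r div \<Prod>S dvd n then of_nat (r div \<Prod>S) else 0))"
proof -
  let ?\<omega> = "cis (2 * pi / real r)" and ?P = "prime_factors r"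
  have inner: "(\<Sum>a\<in>{0<..r}. (if \<Prod>S dvd a then 1 else 0) * ?\<omega> ^ (a * n)) =
      (if r div \<Prod>S dvd n then of_nat (r div \<Prod>S) else 0)" if "S \<in> Pow ?P" for S
  proof -
    define q where "q = \<Prod>S"
    have "q dvd r"
      unfolding q_def using that by (intro prod_prime_factors_subset_dvd) auto
    then obtain m where m: "r = q * m" by auto
    with assms have pos: "q > 0" "m > 0" by auto
    have "(\<Sum>a\<in>{0<..r}. (if q dvd a then 1 else 0) * ?\<omega> ^ (a * n)) =
        (\<Sum>a\<in>{a\<in>{0<..r}. q dvd a}. ?\<omega> ^ (a * n))"
      by (intro sum.mono_neutral_cong_right) auto
    also have "\<dots> = (\<Sum>k=1..m. ?\<omega> ^ (q * k * n))"
      using pos m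
      by (intro sum.reindex_bij_witness[where i = "\<lambda>k. q * k" and j = "\<lambda>a. a div q"]) auto
    also have "\<dots> = (\<Sum>k=1..m. (cis (2 * pi / real m) ^ n) ^ k)"
    proof (intro sum.cong refl)
      fix k
      have "?\<omega> ^ q = cis (2 * pi / real m)"
        using pos by (simp only: Complex.DeMoivre) (simp add: m)
      hence "(cis (2 * pi / real m) ^ n) ^ k = ?\<omega> ^ (q * n * k)"
        by (simp only: power_mult)
      thus "?\<omega> ^ (q * k * n) = (cis (2 * pi / real m) ^ n) ^ k"
        by (simp only: mult_ac)
    qed
    also have "\<dots> = (if m dvd n then of_nat m else 0)"
      using pos by (intro sum_powers_root_of_unity) auto
    finally show ?thesis using pos by (simp add: m flip: q_def)
  qed
  have "ramanujan_sum r n = (\<Sum>a\<in>{0<..r}. (if coprime a r then 1 else 0) * ?\<omega> ^ (a * n))"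
    unfolding ramanujan_sum_def totatives_def
    by (intro sum.mono_neutral_cong_left) auto
  also have "\<dots> = (\<Sum>a\<in>{0<..r}. \<Sum>S\<in>Pow ?P.
      (- 1) ^ card S * ((if \<Prod>S dvd a then 1 else 0) * ?\<omega> ^ (a * n)))"
    by (simp only: coprime_indicator_eq_sum_Pow[OF assms] sum_distrib_right mult.assoc)
  also have "\<dots> = (\<Sum>S\<in>Pow ?P. (- 1) ^ card S *
      (\<Sum>a\<in>{0<..r}. (if \<Prod>S dvd a then 1 else 0) * ?\<omega> ^ (a * n)))"
    by (subst sum.swap) (simp only: sum_distrib_left)
  also have "\<dots> = (\<Sum>S\<in>Pow ?P. (- 1) ^ card S *
      (if r div \<Prod>S dvd n then of_nat (r div \<Prod>S) else 0))"
    using inner by (intro sum.cong) auto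
  finally show ?thesis .
qed

text \<open>For d | r the weight \<open>w d\<close> is \<mu>(r/d). What the later estimates take
  from it is that it has norm at most 1 and is the same for all \<open>n\<close>.\<close>

lemma ramanujan_sum_divisor_expansion:
  assumes "r > 0"
  obtains w :: "nat \<Rightarrow> complex" where "\<And>d. norm (w d) \<le> 1"
    and "\<And>n. ramanujan_sum r n =
      (\<Sum>d | d dvd r. w d * (if d dvd n then of_nat d else 0))"
proof -
  let ?P = "prime_factors r"
  let ?\<phi> = "\<lambda>S. r div \<Prod>S"
  have dvd: "\<Prod>S dvd r" if "S \<in> Pow ?P" for S
    using that by (intro prod_prime_factors_subset_dvd) auto
  have inj: "inj_on ?\<phi> (Pow ?P)"
  proof (rule inj_onI)
    fix S T assume ST: "S \<in> Pow ?P" "T \<in> Pow ?P" "?\<phi> S = ?\<phi> T"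
    have "\<Prod>S = \<Prod>T"
      using dvd[OF ST(1)] dvd[OF ST(2)] ST(3) assms
      by (metis dvd_div_eq_0_iff dvd_div_mult_self mult_left_cancel neq0_conv)
    thus "S = T"
      using inj_on_prod_primes[of ?P] ST(1,2) by (auto simp: inj_on_def)
  qed
  \<comment> \<open>\<open>inv_into\<close> recovers the prime set from d = r div
    \<open>\<Prod>S\<close>. The value 0 elsewhere covers the divisors d with r/d not squarefree, so
    the sum extends to all divisors of \<open>r\<close>.\<close>
  define w where "w d = (if d \<in> ?\<phi> ` Pow ?P
    then (- 1) ^ card (inv_into (Pow ?P) ?\<phi> d) else (0::complex))" for d
  have "ramanujan_sum r n = (\<Sum>d | d dvd r. w d * (if d dvd n then of_nat d else 0))" for n
  proof -
    have "ramanujan_sum r n =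
        (\<Sum>S\<in>Pow ?P. w (?\<phi> S) * (if ?\<phi> S dvd n then of_nat (?\<phi> S) else 0))"
      unfolding ramanujan_sum_eq_sum_Pow[OF assms]
      by (intro sum.cong refl) (simp add: w_def inv_into_f_f[OF inj])
    also have "\<dots> = (\<Sum>d\<in>?\<phi> ` Pow ?P. w d * (if d dvd n then of_nat d else 0))"
      by (subst sum.reindex[OF inj]) simp
    also have "\<dots> = (\<Sum>d | d dvd r. w d * (if d dvd n then of_nat d else 0))"
    proof (rule sum.mono_neutral_left)
      show "finite {d. d dvd r}" using assms by simp
      show "?\<phi> ` Pow ?P \<subseteq> {d. d dvd r}"
        using dvd by (metis (no_types, lifting) dvd_div_mult_self dvd_triv_left image_subsetI mem_Collect_eq)
    qed (auto simp: w_def)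
    finally show ?thesis .
  qed
  moreover have "norm (w d) \<le> 1" for d
    by (simp add: w_def norm_power)
  ultimately show ?thesis using that by blast
qed


section \<open>Counting simultaneous divisibility conditions\<close>

text \<open>The multiples of \<open>L\<close> up to \<open>N + k\<close> split into those up to
  \<open>k\<close> and those above. The additive form avoids truncated subtraction of
  naturals.\<close>

lemma card_dvd_shift:
  assumes "L > 0"
  shows "card {n\<in>{1..N}. L dvd n + k} + k div L = (N + k) div L"
proof (induction N)
  case (Suc N)
  have "{n\<in>{1..Suc N}. L dvd n + k} =
      (if L dvd Suc N + k then insert (Suc N) {n\<in>{1..N}. L dvd n + k}
       else {n\<in>{1..N}. L dvd n + k})"
    by (auto simp: le_Suc_eq)
  with Suc show ?case
    by (simp add: div_Suc dvd_eq_mod_eq_0)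
qed simp

text \<open>The density \<open>\<rho>\<close> is at most \<open>h / (d * e)\<close> because the two divisibility
  conditions are compatible only if \<open>gcd d e\<close> divides \<open>h\<close>.\<close>

lemma card_dvd_dvd_shift:
  fixes d e h :: nat
  assumes "d > 0" "e > 0" "h > 0"
  obtains \<rho> :: real where "0 \<le> \<rho>" and "real d * real e * \<rho> \<le> real h"
    and "\<And>N. \<bar>real (card {n\<in>{1..N}. d dvd n \<and> e dvd n + h}) - real N * \<rho>\<bar> \<le> 1"
proof (cases "\<exists>n. d dvd n \<and> e dvd n + h")
  case False
  show ?thesis
  proof (rule that[of 0])
    fix N
    have "{n\<in>{1..N}. d dvd n \<and> e dvd n + h} = {}" using False by auto
    thus "\<bar>real (card {n\<in>{1..N}. d dvd n \<and> e dvd n + h}) - real N * 0\<bar> \<le> 1"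
      by (simp only: card.empty)
  qed simp_all
next
  case True
  then obtain m where m: "d dvd m" "e dvd m + h" by blast
  define L where "L = lcm d e"
  have L: "L > 0" "d dvd L" "e dvd L" using assms by (auto simp: L_def lcm_pos_nat)
  \<comment> \<open>A nonnegative representative of -m modulo \<open>L\<close>: the solutions
    \<open>n\<close> form the residue class of \<open>m\<close>, that is,
    \<open>L dvd n + k\<close>.\<close>
  define k where "k = L * m - m"
  have km: "k + m = L * m" using L(1) by (simp add: k_def)
  have iff: "d dvd n \<and> e dvd n + h \<longleftrightarrow> L dvd n + k" for n
  proof -
    have "d dvd k + m" unfolding km using L by simp
    hence "d dvd k" using m(1) by (simp add: dvd_add_left_iff)
    hence 1: "d dvd n + k \<longleftrightarrow> d dvd n" by (simp add: dvd_add_left_iff)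
    have eq: "(n + k) + (m + h) = (n + h) + L * m" using km by simp
    have "e dvd n + k \<longleftrightarrow> e dvd (n + k) + (m + h)" using m(2) by (simp add: dvd_add_left_iff)
    also have "\<dots> \<longleftrightarrow> e dvd n + h" unfolding eq using L(3) by (simp add: dvd_add_left_iff)
    finally show ?thesis unfolding L_def using 1 by simp
  qed
  have "gcd d e dvd m" "gcd d e dvd m + h" using m by (meson dvd_trans gcd_dvd1 gcd_dvd2)+
  hence "gcd d e dvd h" by (simp add: dvd_add_right_iff)
  hence g: "gcd d e \<le> h" using assms by (auto dest: dvd_imp_le)
  have "real d * real e = real (gcd d e) * real L"
    using prod_gcd_lcm_nat[of d e] by (simp only: L_def flip: of_nat_mult)
  hence "real d * real e * (1 / real L) \<le> real h"
    using L(1) g by simp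
  moreover have "\<bar>real (card {n\<in>{1..N}. d dvd n \<and> e dvd n + h}) - real N * (1 / real L)\<bar> \<le> 1" for N
  proof -
    have "real (card {n\<in>{1..N}. L dvd n + k}) = real ((N + k) div L) - real (k div L)"
      using card_dvd_shift[OF L(1), of N k] by (metis add_diff_cancel_right' of_nat_add)
    \<comment> \<open>Both roundings, at \<open>N + k\<close> and at \<open>k\<close>, lie in
      [0, 1], so their difference is at most 1 in absolute value.\<close>
    moreover have "real (x div L) \<le> real x / real L \<and> real x / real L \<le> real (x div L) + 1" for x
    proof -
      have "real x = real L * real (x div L) + real (x mod L)"
        by (simp only: mult_div_mod_eq flip: of_nat_add of_nat_mult)
      moreover have "real (x mod L) \<le> real L" using L(1) by (simp add: less_imp_le)
      ultimately show ?thesis using L(1) by (auto simp: field_simps)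
    qed
    note this[of "N + k"] this[of k]
    ultimately show ?thesis
      unfolding iff abs_le_iff by (simp add: add_divide_distrib)
  qed
  ultimately show ?thesis by (intro that[of "1 / real L"]) auto
qed

section \<open>Correlation of two Ramanujan sums over full periods\<close>

text \<open>Negation permutes the units modulo \<open>r\<close>, so -b has exactly one
  representative among the totatives.\<close>

lemma card_totatives_dvd_add:
  assumes "b \<in> totatives r"
  shows "card {a \<in> totatives r. r dvd a + b} = 1"
proof (cases "r = 1")
  \<comment> \<open>Here the representative is 1, whereas the general formula \<open>r - b\<close>
    would give 0.\<close>
  case True
  with assms have "{a \<in> totatives r. r dvd a + b} = {1}" by auto
  thus ?thesis by simp
next
  case False
  hence r: "r > 1" using assms by (cases r) auto
  have b: "0 < b" "b < r" using assms r totatives_less by (auto simp: in_totatives_iff)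
  have "{a \<in> totatives r. r dvd a + b} = {r - b}"
  proof (intro equalityI subsetI)
    fix a assume "a \<in> {a \<in> totatives r. r dvd a + b}"
    hence a: "0 < a" "a < r" "r dvd a + b"
      using r totatives_less by (auto simp: in_totatives_iff)
    then obtain q where q: "a + b = r * q" by auto
    have "0 < q" using q b by (cases q) auto
    moreover have "q < 2"
    proof (rule ccontr)
      assume "\<not> q < 2"
      hence "r * 2 \<le> r * q" by (intro mult_le_mono2) simp
      thus False using q a b by linarith
    qed
    ultimately have "q = 1" by simp
    thus "a \<in> {r - b}" using q by simp
  next
    fix a assume "a \<in> {r - b}"
    hence a: "a = r - b" by simp
    have "coprime (r - b) r"
      using assms b gcd_diff2_nat[of b r]
      by (simp add: in_totatives_iff coprime_iff_gcd_eq_1 gcd_diff1_nat gcd.commute)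
    thus "a \<in> {a \<in> totatives r. r dvd a + b}"
      using a b by (auto simp: in_totatives_iff)
  qed
  thus ?thesis by simp
qed

text \<open>The left side says that a/r + b/s is an integer. Both fractions are in lowest terms, so
  their denominators must agree.\<close>

lemma totatives_cross_dvd_iff:
  assumes "r > 0" "s > 0" "a \<in> totatives r" "b \<in> totatives s"
  shows "r * s dvd a * s + b * r \<longleftrightarrow> r = s \<and> r dvd a + b"
proof
  assume dvd: "r * s dvd a * s + b * r"
  have cop: "coprime a r" "coprime b s" using assms by (auto simp: in_totatives_iff)
  have "r dvd a * s + b * r" "s dvd a * s + b * r"
    using dvd dvd_mult_left dvd_mult_right by blast+
  hence "r dvd a * s" "s dvd b * r" by (simp_all add: dvd_add_left_iff dvd_add_right_iff)
  hence "r dvd s" "s dvd r"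
    using cop by (simp_all add: coprime_dvd_mult_right_iff coprime_commute)
  hence eq: "r = s" by (simp add: dvd_antisym)
  with dvd have "r * r dvd r * (a + b)" by (simp add: algebra_simps)
  with eq assms show "r = s \<and> r dvd a + b" by simp
next
  assume "r = s \<and> r dvd a + b"
  moreover from this have "r * r dvd r * (a + b)" by (intro mult_dvd_mono) auto
  ultimately show "r * s dvd a * s + b * r" by (auto simp: algebra_simps)
qed

text \<open>Expanding both factors into exponentials and summing over \<open>n\<close> first,
  orthogonality keeps only the pairs with a/r + b/s an integer. For \<open>r = s\<close> each
  \<open>b\<close> has one partner \<open>a\<close>, and the remaining phases \<open>?u b\<close>
  add up to \<open>ramanujan_sum r h\<close>.\<close>

lemma sum_ramanujan_sum_shift_period:
  assumes "r > 0" "s > 0" "r * s dvd M"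
  shows "(\<Sum>n=1..M. ramanujan_sum r n * ramanujan_sum s (n + h)) =
    of_nat M * (if r = s then ramanujan_sum r h else 0)"
proof -
  \<comment> \<open>A common root of order \<open>r * s\<close>, of which both families of
    exponentials are powers.\<close>
  define \<omega> where "\<omega> = cis (2 * pi / real (r * s))"
  let ?u = "\<lambda>b. cis (2 * pi / real s) ^ (b * h)"
  have roots: "cis (2 * pi / real r) = \<omega> ^ s" "cis (2 * pi / real s) = \<omega> ^ r"
    unfolding \<omega>_def Complex.DeMoivre using assms by simp_all
  have summand: "cis (2 * pi / real r) ^ (a * n) * cis (2 * pi / real s) ^ (b * (n + h)) =
      ?u b * (\<omega> ^ (a * s + b * r)) ^ n" for a b n
    unfolding roots power_mult[symmetric] power_add[symmetric]
    by (rule arg_cong[where f = "\<lambda>k. \<omega> ^ k"]) (simp add: algebra_simps)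
  have inner: "(\<Sum>n=1..M. ?u b * (\<omega> ^ (a * s + b * r)) ^ n) =
      ?u b * (if r = s \<and> r dvd a + b then of_nat M else 0)"
    if "a \<in> totatives r" "b \<in> totatives s" for a b
    using sum_powers_root_of_unity[of "r * s" M "a * s + b * r"] assms
      totatives_cross_dvd_iff[OF assms(1,2) that]
    by (simp only: \<omega>_def sum_distrib_left[symmetric] nat_0_less_mult_iff simp_thms)
  have "(\<Sum>n=1..M. ramanujan_sum r n * ramanujan_sum s (n + h)) =
      (\<Sum>n=1..M. \<Sum>a\<in>totatives r. \<Sum>b\<in>totatives s. ?u b * (\<omega> ^ (a * s + b * r)) ^ n)"
    unfolding ramanujan_sum_def sum_product
    by (simp only: summand)
  also have "\<dots> = (\<Sum>b\<in>totatives s. \<Sum>n=1..M. \<Sum>a\<in>totatives r. ?u b * (\<omega> ^ (a * s + b * r)) ^ n)"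
    by (subst sum.swap[where A = "totatives r"]) (rule sum.swap)
  also have "\<dots> = (\<Sum>b\<in>totatives s. \<Sum>a\<in>totatives r. \<Sum>n=1..M. ?u b * (\<omega> ^ (a * s + b * r)) ^ n)"
    by (intro sum.cong refl sum.swap)
  also have "\<dots> = (\<Sum>b\<in>totatives s. \<Sum>a\<in>totatives r.
      ?u b * (if r = s \<and> r dvd a + b then of_nat M else 0))"
    by (intro sum.cong refl inner)
  also have "\<dots> = of_nat M * (if r = s then ramanujan_sum r h else 0)"
  proof (cases "r = s")
    case True
    have "(\<Sum>a\<in>totatives r. ?u b * (if r = s \<and> r dvd a + b then of_nat M else 0)) =
        of_nat M * ?u b" if "b \<in> totatives s" for b
    proof -
      have "(\<Sum>a\<in>totatives r. ?u b * (if r = s \<and> r dvd a + b then of_nat M else 0)) =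
          (\<Sum>a\<in>{a \<in> totatives r. r dvd a + b}. ?u b * of_nat M)"
        using True by (intro sum.mono_neutral_cong_right) auto
      thus ?thesis using that True by (simp add: card_totatives_dvd_add)
    qed
    thus ?thesis using True by (simp add: ramanujan_sum_def sum_distrib_left)
  qed simp
  finally show ?thesis .
qed


section \<open>The error for a single pair of moduli\<close>

text \<open>In the range \<open>d \<le> N\<close>, \<open>e \<le> N + h\<close> the error is at most
  1, and (de)^(1-\<theta>) is at most (1+h) N^(2-2\<theta>), because N + h \<le> (1+h) N. Outside it
  \<open>A = 0\<close>, so the left side is at most hN, while (de)^\<theta> \<ge> N^\<theta> and N
  \<le> N^(2-\<theta>).\<close>

lemma mult_error_bound_powr:
  fixes d e h N :: nat and A \<rho> \<theta> :: real
  assumes pos: "d > 0" "e > 0" "N > 0" and \<theta>: "0 \<le> \<theta>" "\<theta> \<le> 1"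
    and \<rho>: "0 \<le> \<rho>" "real d * real e * \<rho> \<le> real h"
    and err: "\<bar>A - real N * \<rho>\<bar> \<le> 1"
    and zero: "d > N \<or> e > N + h \<Longrightarrow> A = 0"
  shows "real d * real e * \<bar>A - real N * \<rho>\<bar> \<le>
    (1 + real h) * real N powr (2 - 2 * \<theta>) * (real d powr \<theta> * real e powr \<theta>)"
proof (cases "d > N \<or> e > N + h")
  case False
  have split: "real x = real x powr \<theta> * real x powr (1 - \<theta>)" if "x > 0" for x :: nat
    using that by (simp flip: powr_add)
  have d: "real d powr (1 - \<theta>) \<le> real N powr (1 - \<theta>)"
    using False \<theta> by (intro powr_mono2) auto
  have "1 * real h \<le> real N * real h"
    using pos(3) by (intro mult_right_mono) auto
  hence "real (N + h) \<le> (1 + real h) * real N"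
    by (simp add: algebra_simps)
  hence "real e powr (1 - \<theta>) \<le> ((1 + real h) * real N) powr (1 - \<theta>)"
    using False \<theta> by (intro powr_mono2) auto
  also have "\<dots> = (1 + real h) powr (1 - \<theta>) * real N powr (1 - \<theta>)"
    by (simp add: powr_mult)
  also have "\<dots> \<le> (1 + real h) powr 1 * real N powr (1 - \<theta>)"
    using \<theta> by (intro mult_right_mono powr_mono) auto
  finally have e: "real e powr (1 - \<theta>) \<le> (1 + real h) * real N powr (1 - \<theta>)"
    by simp
  have "real d * real e * \<bar>A - real N * \<rho>\<bar> \<le> real d * real e * 1"
    using err by (intro mult_left_mono) auto
  also have "\<dots> = (real d powr \<theta> * real d powr (1 - \<theta>)) * (real e powr \<theta> * real e powr (1 - \<theta>))"
    using split[OF pos(1), symmetric] split[OF pos(2), symmetric] by simp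
  also have "\<dots> = (real d powr \<theta> * real e powr \<theta>) * (real d powr (1 - \<theta>) * real e powr (1 - \<theta>))"
    by (simp only: mult_ac)
  also have "\<dots> \<le> (real d powr \<theta> * real e powr \<theta>) *
      (real N powr (1 - \<theta>) * ((1 + real h) * real N powr (1 - \<theta>)))"
    using d e by (intro mult_left_mono mult_mono) auto
  also have "real N powr (1 - \<theta>) * ((1 + real h) * real N powr (1 - \<theta>)) =
      (1 + real h) * real N powr (2 - 2 * \<theta>)"
    by (simp add: algebra_simps flip: powr_add)
  finally show ?thesis by (simp add: mult_ac)
next
  case True
  \<comment> \<open>One of \<open>d\<close>, \<open>e\<close> exceeds \<open>N\<close>; the other is
    at least 1.\<close>
  have "real N powr \<theta> * 1 \<le> real d powr \<theta> * real e powr \<theta>"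
  proof (cases "d > N")
    case True
    with pos \<theta> show ?thesis by (intro mult_mono powr_mono2 ge_one_powr_ge_zero) auto
  next
    case False
    with True pos \<theta> have "1 * real N powr \<theta> \<le> real d powr \<theta> * real e powr \<theta>"
      by (intro mult_mono powr_mono2 ge_one_powr_ge_zero) auto
    thus ?thesis by simp
  qed
  hence "real N powr (2 - 2 * \<theta>) * real N powr \<theta> \<le>
      real N powr (2 - 2 * \<theta>) * (real d powr \<theta> * real e powr \<theta>)"
    by (intro mult_left_mono) auto
  moreover have "real N powr 1 \<le> real N powr (2 - \<theta>)"
    using pos \<theta> by (intro powr_mono) auto
  ultimately have N: "real N \<le> real N powr (2 - 2 * \<theta>) * (real d powr \<theta> * real e powr \<theta>)"
    by (simp flip: powr_add)
  have "real d * real e * \<bar>A - real N * \<rho>\<bar> = real N * (real d * real e * \<rho>)"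
    using zero[OF True] \<rho> by (simp add: abs_mult)
  also have "\<dots> \<le> real N * (1 + real h)"
    using \<rho> by (intro mult_left_mono) auto
  also have "\<dots> \<le> real N powr (2 - 2 * \<theta>) * (real d powr \<theta> * real e powr \<theta>) * (1 + real h)"
    using N by (intro mult_right_mono) auto
  finally show ?thesis by (simp add: mult_ac)
qed

text \<open>The Archimedean property; it identifies the leading coefficient of the correlation from
  its values at multiples of a period.\<close>

lemma eq_if_all_nat_multiples_bounded:
  fixes x y :: complex
  assumes "m > 0" and "\<And>k::nat. norm (of_nat (k * m) * (x - y)) \<le> B"
  shows "x = y"
proof (rule ccontr)
  assume "x \<noteq> y"
  hence "norm (of_nat m * (x - y)) > 0" using assms(1) by simp
  then obtain k :: nat where "B < of_nat k * norm (of_nat m * (x - y))"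
    using ex_less_of_nat_mult by blast
  with assms(2)[of k] show False by (simp add: norm_mult mult_ac)
qed

text \<open>The divisor expansions reduce the correlation to the counts \<open>A N d e\<close>,
  whose densities combine to a coefficient \<open>M\<close>. The value of \<open>M\<close> comes
  from the exact formula over full periods, with no evaluation of the densities; the remaining
  errors are bounded term by term.\<close>

lemma norm_sum_ramanujan_sum_shift_le:
  fixes r s h N :: nat and \<theta> :: real
  assumes pos: "r > 0" "s > 0" "h > 0" "N > 0" and \<theta>: "0 \<le> \<theta>" "\<theta> \<le> 1"
  shows "norm ((\<Sum>n=1..N. ramanujan_sum r n * ramanujan_sum s (n + h)) -
      of_nat N * (if r = s then ramanujan_sum r h else 0)) \<le>
    (1 + real h) * real N powr (2 - 2 * \<theta>) *
      ((\<Sum>d | d dvd r. real d powr \<theta>) * (\<Sum>e | e dvd s. real e powr \<theta>))"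
proof -
  let ?R = "{d. d dvd r}" and ?S = "{e. e dvd s}"
  let ?\<kappa> = "if r = s then ramanujan_sum r h else 0"
  define A where "A N d e = card {n\<in>{1..N}. d dvd n \<and> e dvd n + h}" for N d e
  obtain w where w: "\<And>d. norm (w d) \<le> 1" and w_sum:
    "\<And>n. ramanujan_sum r n = (\<Sum>d\<in>?R. w d * (if d dvd n then of_nat d else 0))"
    using ramanujan_sum_divisor_expansion[OF pos(1)] by blast
  obtain v where v: "\<And>e. norm (v e) \<le> 1" and v_sum:
    "\<And>n. ramanujan_sum s n = (\<Sum>e\<in>?S. v e * (if e dvd n then of_nat e else 0))"
    using ramanujan_sum_divisor_expansion[OF pos(2)] by blast
  \<comment> \<open>The density must serve all \<open>N\<close> at once: it is used below both for
    the given \<open>N\<close> and for all multiples of \<open>r * s\<close>.\<close>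
  have "\<exists>\<rho>\<ge>0. real d * real e * \<rho> \<le> real h \<and> (\<forall>N. \<bar>real (A N d e) - real N * \<rho>\<bar> \<le> 1)"
    if "d > 0" "e > 0" for d e
    using card_dvd_dvd_shift[OF that pos(3)] unfolding A_def by metis
  then obtain \<rho> where \<rho>: "\<And>d e. d > 0 \<Longrightarrow> e > 0 \<Longrightarrow> \<rho> d e \<ge> 0"
      "\<And>d e. d > 0 \<Longrightarrow> e > 0 \<Longrightarrow> real d * real e * \<rho> d e \<le> real h"
      "\<And>d e N. d > 0 \<Longrightarrow> e > 0 \<Longrightarrow> \<bar>real (A N d e) - real N * \<rho> d e\<bar> \<le> 1"
    by metis
  have dpos: "d > 0" if "d \<in> ?R" for d using that pos(1) by (auto intro: Nat.gr0I)
  have epos: "e > 0" if "e \<in> ?S" for e using that pos(2) by (auto intro: Nat.gr0I)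
  define M where "M = (\<Sum>d\<in>?R. \<Sum>e\<in>?S. w d * v e * of_real (real d * real e * \<rho> d e))"
  have expand: "(\<Sum>n=1..N. ramanujan_sum r n * ramanujan_sum s (n + h)) =
      (\<Sum>d\<in>?R. \<Sum>e\<in>?S. w d * v e * of_real (real d * real e * real (A N d e)))" for N
  proof -
    have "(\<Sum>n=1..N. ramanujan_sum r n * ramanujan_sum s (n + h)) =
        (\<Sum>n=1..N. \<Sum>d\<in>?R. \<Sum>e\<in>?S. w d * v e * of_real (real d * real e) *
          (if d dvd n \<and> e dvd n + h then 1 else 0))"
      unfolding w_sum v_sum sum_product by (intro sum.cong refl) auto
    also have "\<dots> = (\<Sum>d\<in>?R. \<Sum>e\<in>?S. \<Sum>n=1..N. w d * v e * of_real (real d * real e) *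
          (if d dvd n \<and> e dvd n + h then 1 else 0))"
      by (subst sum.swap) (intro sum.cong refl sum.swap)
    also have "\<dots> = (\<Sum>d\<in>?R. \<Sum>e\<in>?S. w d * v e * of_real (real d * real e * real (A N d e)))"
    proof (intro sum.cong refl)
      fix d e
      have "(\<Sum>n=1..N. if d dvd n \<and> e dvd n + h then 1 else (0::complex)) =
          (\<Sum>n\<in>{n\<in>{1..N}. d dvd n \<and> e dvd n + h}. 1)"
        by (intro sum.mono_neutral_cong_right) auto
      thus "(\<Sum>n=1..N. w d * v e * of_real (real d * real e) *
          (if d dvd n \<and> e dvd n + h then 1 else 0)) =
          w d * v e * of_real (real d * real e * real (A N d e))"
        unfolding sum_distrib_left[symmetric] by (simp add: A_def)
    qed
    finally show ?thesis .
  qed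
  have diff: "norm ((\<Sum>n=1..N. ramanujan_sum r n * ramanujan_sum s (n + h)) - of_nat N * M) \<le>
      (\<Sum>d\<in>?R. \<Sum>e\<in>?S. real d * real e * \<bar>real (A N d e) - real N * \<rho> d e\<bar>)" for N
  proof -
    have eq: "(\<Sum>n=1..N. ramanujan_sum r n * ramanujan_sum s (n + h)) - of_nat N * M =
        (\<Sum>d\<in>?R. \<Sum>e\<in>?S. w d * v e *
          of_real (real d * real e * (real (A N d e) - real N * \<rho> d e)))"
      unfolding expand M_def sum_distrib_left sum_subtractf[symmetric]
      by (intro sum.cong refl) (simp add: algebra_simps)
    have "norm ((\<Sum>n=1..N. ramanujan_sum r n * ramanujan_sum s (n + h)) - of_nat N * M) \<le>
        (\<Sum>d\<in>?R. \<Sum>e\<in>?S. norm (w d * v e *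
          of_real (real d * real e * (real (A N d e) - real N * \<rho> d e))))"
      unfolding eq by (intro order.trans[OF norm_sum] sum_mono norm_sum)
    also have "\<dots> \<le> (\<Sum>d\<in>?R. \<Sum>e\<in>?S. real d * real e * \<bar>real (A N d e) - real N * \<rho> d e\<bar>)"
    proof (intro sum_mono)
      fix d e
      have "norm (w d) * norm (v e) \<le> 1" using w[of d] v[of e] by (intro mult_le_one) auto
      hence "norm (w d) * norm (v e) * norm (complex_of_real (real d * real e *
          (real (A N d e) - real N * \<rho> d e))) \<le> 1 * norm (complex_of_real (real d * real e *
          (real (A N d e) - real N * \<rho> d e)))"
        by (intro mult_right_mono) auto
      thus "norm (w d * v e * of_real (real d * real e * (real (A N d e) - real N * \<rho> d e))) \<le>
          real d * real e * \<bar>real (A N d e) - real N * \<rho> d e\<bar>"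
        by (simp only: norm_mult norm_of_real abs_mult abs_of_nat mult_1)
    qed
    finally show ?thesis .
  qed
  \<comment> \<open>At N = k r s the correlation is exactly N times \<open>?\<kappa>\<close>, while
    \<open>diff\<close> keeps it within a bound independent of k from N times
    \<open>M\<close>.\<close>
  have "?\<kappa> = M"
  proof (rule eq_if_all_nat_multiples_bounded)
    show "r * s > 0" using pos by simp
    fix k
    have "norm (of_nat (k * (r * s)) * (?\<kappa> - M)) =
        norm ((\<Sum>n=1..k * (r * s). ramanujan_sum r n * ramanujan_sum s (n + h)) -
          of_nat (k * (r * s)) * M)"
      using sum_ramanujan_sum_shift_period[of r s "k * (r * s)" h] pos
      by (simp only: right_diff_distrib dvd_triv_right)
    also note diff
    also have "(\<Sum>d\<in>?R. \<Sum>e\<in>?S. real d * real e *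
        \<bar>real (A (k * (r * s)) d e) - real (k * (r * s)) * \<rho> d e\<bar>) \<le>
        (\<Sum>d\<in>?R. \<Sum>e\<in>?S. real d * real e * 1)"
      using dpos epos by (intro sum_mono mult_left_mono \<rho>(3)) auto
    finally show "norm (of_nat (k * (r * s)) * (?\<kappa> - M)) \<le> (\<Sum>d\<in>?R. \<Sum>e\<in>?S. real d * real e * 1)" .
  qed
  hence "norm ((\<Sum>n=1..N. ramanujan_sum r n * ramanujan_sum s (n + h)) - of_nat N * ?\<kappa>) \<le>
      (\<Sum>d\<in>?R. \<Sum>e\<in>?S. real d * real e * \<bar>real (A N d e) - real N * \<rho> d e\<bar>)"
    using diff by simp
  also have "\<dots> \<le> (\<Sum>d\<in>?R. \<Sum>e\<in>?S. (1 + real h) * real N powr (2 - 2 * \<theta>) *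
      (real d powr \<theta> * real e powr \<theta>))"
  proof (intro sum_mono mult_error_bound_powr)
    fix d e assume de: "d \<in> ?R" "e \<in> ?S"
    show d: "d > 0" and e: "e > 0" using dpos epos de by auto
    show "0 \<le> \<rho> d e" by (rule \<rho>(1)[OF d e])
    show "real d * real e * \<rho> d e \<le> real h" by (rule \<rho>(2)[OF d e])
    show "\<bar>real (A N d e) - real N * \<rho> d e\<bar> \<le> 1" by (rule \<rho>(3)[OF d e])
    assume large: "d > N \<or> e > N + h"
    \<comment> \<open>As \<open>n\<close> starts at 1, both \<open>n\<close> and
      \<open>n + h\<close> are positive, so a divisor cannot exceed them.\<close>
    have "{n\<in>{1..N}. d dvd n \<and> e dvd n + h} = {}"
    proof -
      have "d \<le> N \<and> e \<le> N + h" if "n \<in> {1..N}" "d dvd n" "e dvd n + h" for n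
        using that dvd_imp_le[of d n] dvd_imp_le[of e "n + h"] by auto
      thus ?thesis using large by fastforce
    qed
    thus "real (A N d e) = 0" unfolding A_def by simp
  qed (use pos \<theta> in auto)
  also have "\<dots> = (1 + real h) * real N powr (2 - 2 * \<theta>) *
      ((\<Sum>d\<in>?R. real d powr \<theta>) * (\<Sum>e\<in>?S. real e powr \<theta>))"
    unfolding sum_product by (simp only: sum_distrib_left)
  finally show ?thesis .
qed


section \<open>Summation over all pairs of moduli\<close>

text \<open>The series is \<zeta>(a): its term at 0 vanishes because
  \<open>0 powr x = 0\<close>.\<close>

lemma sum_powr_le_suminf:
  assumes "a > 1"
  shows "(\<Sum>n=1..R. real n powr (- a)) \<le> (\<Sum>n. real n powr (- a))"
  using assms by (intro sum_le_suminf) (auto simp: summable_real_powr_iff)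

text \<open>A truncation of the Dirichlet series identity for the divisor sums \<sigma>_\<theta>,
  whose series at s is \<zeta>(s) \<zeta>(s - \<theta>), here at s = 1 + \<delta>. The condition
  \<open>\<theta> < \<delta>\<close> puts both arguments above 1.\<close>

lemma sum_powr_divisor_sum_le:
  fixes \<delta> \<theta> :: real
  assumes "\<theta> < \<delta>" "0 < \<delta>"
  shows "(\<Sum>r=1..R. real r powr (- (1 + \<delta>)) * (\<Sum>d | d dvd r. real d powr \<theta>)) \<le>
    (\<Sum>d. real d powr (- (1 + \<delta> - \<theta>))) * (\<Sum>m. real m powr (- (1 + \<delta>)))"
proof -
  let ?g = "\<lambda>(d, m). real d powr (- (1 + \<delta> - \<theta>)) * real m powr (- (1 + \<delta>))"
  \<comment> \<open>The substitution r = d m separates the variables. It maps the pairs injectively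
    into a square, and extending the sum to that square adds only nonnegative terms.\<close>
  let ?\<phi> = "\<lambda>(r, d). (d, r div d)"
  let ?X = "SIGMA r:{1..R}. {d. d dvd r}"
  have inj: "inj_on ?\<phi> ?X"
    by (auto simp: inj_on_def)
  have sub: "?\<phi> ` ?X \<subseteq> {1..R} \<times> {1..R}"
  proof
    fix x assume "x \<in> ?\<phi> ` ?X"
    then obtain r d where x: "x = (d, r div d)" and rd: "r \<in> {1..R}" "d dvd r" by auto
    have "d \<in> {1..R} \<and> r div d \<in> {1..R}"
      using rd dvd_imp_le[OF rd(2)]
      by (auto simp: Suc_le_eq div_greater_zero_iff intro: Nat.gr0I order.trans[OF div_le_dividend])
    thus "x \<in> {1..R} \<times> {1..R}" unfolding x by (intro SigmaI) simp_all
  qed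
  have "(\<Sum>r=1..R. real r powr (- (1 + \<delta>)) * (\<Sum>d | d dvd r. real d powr \<theta>)) =
      (\<Sum>r=1..R. \<Sum>d | d dvd r. ?g (d, r div d))"
    unfolding sum_distrib_left
  proof (intro sum.cong refl)
    fix r d assume r: "r \<in> {1..R}" and "d \<in> {d. d dvd r}"
    then obtain m where m: "r = d * m" by auto
    with r have "d > 0" "m > 0" by (auto intro: Nat.gr0I)
    thus "real r powr (- (1 + \<delta>)) * real d powr \<theta> = ?g (d, r div d)"
      by (simp add: m powr_mult mult_ac flip: powr_add) (simp add: powr_add powr_diff powr_minus field_simps)
  qed
  also have "\<dots> = (\<Sum>x\<in>?X. ?g (?\<phi> x))"
    by (subst sum.Sigma) (auto intro!: sum.cong)
  also have "\<dots> = sum ?g (?\<phi> ` ?X)"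
    by (subst sum.reindex[OF inj]) simp
  also have "\<dots> \<le> sum ?g ({1..R} \<times> {1..R})"
    using sub by (intro sum_mono2) auto
  also have "\<dots> = (\<Sum>d=1..R. real d powr (- (1 + \<delta> - \<theta>))) * (\<Sum>m=1..R. real m powr (- (1 + \<delta>)))"
    by (simp only: sum_product sum.cartesian_product)
  also have "\<dots> \<le> (\<Sum>d. real d powr (- (1 + \<delta> - \<theta>))) * (\<Sum>m. real m powr (- (1 + \<delta>)))"
    using assms by (intro mult_mono sum_powr_le_suminf sum_nonneg suminf_nonneg)
      (auto simp: summable_real_powr_iff)
  finally show ?thesis .
qed

lemma norm_ramanujan_sum_le: "norm (ramanujan_sum r n) \<le> real r"
proof -
  have "norm (ramanujan_sum r n) \<le> (\<Sum>a\<in>totatives r. 1)"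
    unfolding ramanujan_sum_def by (intro sum_norm_le) (simp add: norm_power)
  also have "\<dots> \<le> real (card {0<..r})"
    unfolding sum_constant mult_1_right of_nat_le_iff
    by (intro card_mono totatives_subset) auto
  finally show ?thesis by simp
qed

text \<open>Truncating both expansions at the same \<open>R\<close> makes the main terms on the
  diagonal \<open>r = s\<close> add up to a partial sum of the series in the theorem.\<close>

lemma sum_ramanujan_partial_products:
  fixes F G :: "nat \<Rightarrow> complex"
  shows "(\<Sum>n=1..N. (\<Sum>r=1..R. F r * ramanujan_sum r n) * (\<Sum>s=1..R. G s * ramanujan_sum s (n + h))) -
      of_nat N * (\<Sum>r=1..R. F r * G r * ramanujan_sum r h) =
    (\<Sum>r=1..R. \<Sum>s=1..R. F r * G s * ((\<Sum>n=1..N. ramanujan_sum r n * ramanujan_sum s (n + h)) -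
      of_nat N * (if r = s then ramanujan_sum r h else 0)))"
proof -
  have "(\<Sum>n=1..N. (\<Sum>r=1..R. F r * ramanujan_sum r n) * (\<Sum>s=1..R. G s * ramanujan_sum s (n + h))) =
      (\<Sum>n=1..N. \<Sum>r=1..R. \<Sum>s=1..R. F r * G s * (ramanujan_sum r n * ramanujan_sum s (n + h)))"
    unfolding sum_product by (simp only: mult_ac)
  also have "\<dots> = (\<Sum>r=1..R. \<Sum>s=1..R. \<Sum>n=1..N.
      F r * G s * (ramanujan_sum r n * ramanujan_sum s (n + h)))"
    by (subst sum.swap) (intro sum.cong refl sum.swap)
  moreover have "of_nat N * (\<Sum>r=1..R. F r * G r * ramanujan_sum r h) =
      (\<Sum>r=1..R. \<Sum>s=1..R. F r * G s * (of_nat N * (if r = s then ramanujan_sum r h else 0)))"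
    unfolding sum_distrib_left
  proof (intro sum.cong refl)
    fix r assume r: "r \<in> {1..R}"
    have "(\<Sum>s=1..R. F r * G s * (of_nat N * (if r = s then ramanujan_sum r h else 0))) =
        (\<Sum>s=1..R. if r = s then of_nat N * (F r * G r * ramanujan_sum r h) else 0)"
      by (intro sum.cong refl) (auto simp: mult_ac)
    with r show "of_nat N * (F r * G r * ramanujan_sum r h) =
        (\<Sum>s=1..R. F r * G s * (of_nat N * (if r = s then ramanujan_sum r h else 0)))"
      by simp
  qed
  ultimately show ?thesis
    by (simp only: right_diff_distrib sum_subtractf sum_distrib_left)
qed

text \<open>Take \<open>r = 1\<close>, where the power is 1. The sign is needed to multiply the
  coefficient bounds.\<close>

lemma coeff_bound_nonneg:
  fixes F :: "nat \<Rightarrow> complex"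
  assumes "\<forall>r\<ge>1. norm (F r) \<le> C * real r powr a"
  shows "C \<ge> 0"
  using assms[rule_format, of 1] norm_ge_zero[of "F 1"] by simp (meson order.trans norm_ge_zero)

text \<open>The bound for each pair factors into a part in \<open>r\<close> and a part in
  \<open>s\<close>, hence the square. It does not depend on \<open>R\<close>, which allows the
  passage to the limit.\<close>

lemma norm_sum_ramanujan_partial_products_le:
  fixes F G :: "nat \<Rightarrow> complex" and \<delta> \<theta> :: real
  assumes pos: "h > 0" "N > 0" and \<theta>: "0 \<le> \<theta>" "\<theta> \<le> 1" "\<theta> < \<delta>"
    and F: "\<forall>r\<ge>1. norm (F r) \<le> C * real r powr (- (1 + \<delta>))"
    and G: "\<forall>r\<ge>1. norm (G r) \<le> D * real r powr (- (1 + \<delta>))"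
  shows "norm ((\<Sum>n=1..N. (\<Sum>r=1..R. F r * ramanujan_sum r n) *
        (\<Sum>s=1..R. G s * ramanujan_sum s (n + h))) -
      of_nat N * (\<Sum>r=1..R. F r * G r * ramanujan_sum r h)) \<le>
    C * D * (1 + real h) * ((\<Sum>d. real d powr (- (1 + \<delta> - \<theta>))) *
      (\<Sum>m. real m powr (- (1 + \<delta>))))\<^sup>2 * real N powr (2 - 2 * \<theta>)"
proof -
  define \<sigma> where "\<sigma> r = (\<Sum>d | d dvd r. real d powr \<theta>)" for r
  let ?a = "\<lambda>r. real r powr (- (1 + \<delta>))"
  let ?K = "(\<Sum>d. real d powr (- (1 + \<delta> - \<theta>))) * (\<Sum>m. real m powr (- (1 + \<delta>)))"
  let ?E = "\<lambda>r s. (\<Sum>n=1..N. ramanujan_sum r n * ramanujan_sum s (n + h)) -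
      of_nat N * (if r = s then ramanujan_sum r h else 0)"
  define B where "B = (1 + real h) * real N powr (2 - 2 * \<theta>)"
  have CD: "C \<ge> 0" "D \<ge> 0" using coeff_bound_nonneg F G by blast+
  have "norm (\<Sum>r=1..R. \<Sum>s=1..R. F r * G s * ?E r s) \<le>
      (\<Sum>r=1..R. \<Sum>s=1..R. norm (F r * G s * ?E r s))"
    by (intro order.trans[OF norm_sum] sum_mono norm_sum)
  also have "\<dots> \<le> (\<Sum>r=1..R. \<Sum>s=1..R. (C * ?a r) * (D * ?a s) * (B * (\<sigma> r * \<sigma> s)))"
  proof (intro sum_mono)
    fix r s assume rs: "r \<in> {1..R}" "s \<in> {1..R}"
    have "norm (?E r s) \<le> B * (\<sigma> r * \<sigma> s)"
      unfolding B_def \<sigma>_def using rs pos \<theta> by (intro norm_sum_ramanujan_sum_shift_le) auto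
    thus "norm (F r * G s * ?E r s) \<le> (C * ?a r) * (D * ?a s) * (B * (\<sigma> r * \<sigma> s))"
      unfolding norm_mult using rs F G CD by (intro mult_mono) auto
  qed
  also have "\<dots> = C * D * B * ((\<Sum>r=1..R. ?a r * \<sigma> r) * (\<Sum>s=1..R. ?a s * \<sigma> s))"
    unfolding sum_product by (simp only: sum_distrib_left mult_ac)
  also have "\<dots> \<le> C * D * B * (?K * ?K)"
    unfolding \<sigma>_def using CD \<theta>
    by (intro mult_left_mono mult_mono sum_powr_divisor_sum_le)
       (auto simp: B_def summable_real_powr_iff intro!: sum_nonneg mult_nonneg_nonneg suminf_nonneg)
  finally show ?thesis
    unfolding sum_ramanujan_partial_products by (simp add: B_def power2_eq_square mult_ac)
qed

section \<open>Passage to the full expansions\<close>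

lemma sums_Suc_imp_tendsto_sum_from_1:
  assumes "(\<lambda>r. f (Suc r)) sums (x :: 'a :: real_normed_vector)"
  shows "(\<lambda>R. \<Sum>r=1..R. f r) \<longlonglongrightarrow> x"
proof -
  have "(\<Sum>r<R. f (Suc r)) = (\<Sum>r=1..R. f r)" for R
    by (intro sum.reindex_bij_witness[where i = "\<lambda>r. r - 1" and j = Suc]) auto
  with assms show ?thesis by (simp add: sums_def)
qed

text \<open>With the trivial bound \<open>r\<close> for the Ramanujan sum, the terms are
  O(r^(-1-2\<delta>)).\<close>

lemma summable_ramanujan_singular_series:
  fixes F G :: "nat \<Rightarrow> complex"
  assumes "\<delta> > 0"
    and F: "\<forall>r\<ge>1. norm (F r) \<le> C * real r powr (- (1 + \<delta>))"
    and G: "\<forall>r\<ge>1. norm (G r) \<le> D * real r powr (- (1 + \<delta>))"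
  shows "summable (\<lambda>r. F (Suc r) * G (Suc r) * ramanujan_sum (Suc r) h)"
proof (rule summable_comparison_test')
  show "summable (\<lambda>r. C * D * real (Suc r) powr (- (1 + 2 * \<delta>)))"
    using assms(1) by (subst summable_Suc_iff, intro summable_mult)
      (auto simp: summable_real_powr_iff)
  fix r :: nat
  let ?r = "Suc r"
  have CD: "C \<ge> 0" "D \<ge> 0" using coeff_bound_nonneg F G by blast+
  have "norm (F ?r * G ?r * ramanujan_sum ?r h) \<le>
      (C * real ?r powr (- (1 + \<delta>))) * (D * real ?r powr (- (1 + \<delta>))) * real ?r powr 1"
    unfolding norm_mult using F G CD norm_ramanujan_sum_le[of ?r h]
    by (intro mult_mono) (auto simp del: of_nat_Suc)
  also have "\<dots> = C * D * (real ?r powr (- (1 + \<delta>)) * real ?r powr (- (1 + \<delta>)) * real ?r powr 1)"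
    by (simp only: mult_ac)
  also have "real ?r powr (- (1 + \<delta>)) * real ?r powr (- (1 + \<delta>)) * real ?r powr 1 =
      real ?r powr (- (1 + 2 * \<delta>))"
    by (simp only: powr_add[symmetric]) (simp add: algebra_simps)
  finally show "norm (F ?r * G ?r * ramanujan_sum ?r h) \<le>
      C * D * real ?r powr (- (1 + 2 * \<delta>))" .
qed

theorem theorem1p2:
  fixes f g F G :: "nat \<Rightarrow> complex" and \<delta> :: real and h :: nat
  assumes "abs_conv_ramanujan_expansion f F"
    and "abs_conv_ramanujan_expansion g G"
    and "\<delta> > 1 / 2"
    and "\<exists>C. \<forall>r\<ge>1. norm (F r) \<le> C * real r powr (- (1 + \<delta>))"
    and "\<exists>C. \<forall>r\<ge>1. norm (G r) \<le> C * real r powr (- (1 + \<delta>))"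
    and "h \<ge> 1"
  shows "summable (\<lambda>r. F (Suc r) * G (Suc r) * ramanujan_sum (Suc r) h) \<and>
    (\<lambda>N::nat. (\<Sum>n=1..N. f n * g (n + h))
        - of_nat N * (\<Sum>r. F (Suc r) * G (Suc r) * ramanujan_sum (Suc r) h))
      \<in> O[at_top](\<lambda>N. complex_of_real
          (real N powr (2 / (1 + 2 * \<delta>)) * ln (real N) powr ((5 + 2 * \<delta>) / (1 + 2 * \<delta>))))"
proof
  obtain C D where F: "\<forall>r\<ge>1. norm (F r) \<le> C * real r powr (- (1 + \<delta>))"
    and G: "\<forall>r\<ge>1. norm (G r) \<le> D * real r powr (- (1 + \<delta>))"
    using assms(4,5) by blast
  show summable: "summable (\<lambda>r. F (Suc r) * G (Suc r) * ramanujan_sum (Suc r) h)"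
    using assms(3) F G by (intro summable_ramanujan_singular_series) auto
  let ?T = "\<Sum>r. F (Suc r) * G (Suc r) * ramanujan_sum (Suc r) h"
  \<comment> \<open>Chosen so that \<open>2 - 2 * \<theta> = 2 / (1 + 2 * \<delta>)\<close>; then \<open>\<theta> < \<delta>\<close> is equivalent to \<open>\<delta> > 1 / 2\<close>.\<close>
  define \<theta> where "\<theta> = 2 * \<delta> / (1 + 2 * \<delta>)"
  have \<theta>: "0 \<le> \<theta>" "\<theta> \<le> 1" "\<theta> < \<delta>" "2 - 2 * \<theta> = 2 / (1 + 2 * \<delta>)"
    using assms(3) by (auto simp: \<theta>_def field_simps)
  define K where "K = C * D * (1 + real h) * ((\<Sum>d. real d powr (- (1 + \<delta> - \<theta>))) *
      (\<Sum>m. real m powr (- (1 + \<delta>))))\<^sup>2"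
  \<comment> \<open>For fixed \<open>N\<close> only finitely many values of \<open>f\<close> and
    \<open>g\<close> occur, so the truncated expression converges as R tends to infinity and
    inherits the bound uniform in R.\<close>
  have bound: "norm ((\<Sum>n=1..N. f n * g (n + h)) - of_nat N * ?T) \<le>
      K * real N powr (2 / (1 + 2 * \<delta>))" if "N > 0" for N :: nat
  proof (rule Lim_norm_ubound)
    have "(\<lambda>R. \<Sum>r=1..R. F r * ramanujan_sum r n) \<longlonglongrightarrow> f n" if "n \<ge> 1" for n
      using assms(1) that by (intro sums_Suc_imp_tendsto_sum_from_1)
        (auto simp: abs_conv_ramanujan_expansion_def ramanujan_expansion_def)
    moreover have "(\<lambda>R. \<Sum>r=1..R. G r * ramanujan_sum r n) \<longlonglongrightarrow> g n" if "n \<ge> 1" for n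
      using assms(2) that by (intro sums_Suc_imp_tendsto_sum_from_1)
        (auto simp: abs_conv_ramanujan_expansion_def ramanujan_expansion_def)
    moreover have "(\<lambda>R. \<Sum>r=1..R. F r * G r * ramanujan_sum r h) \<longlonglongrightarrow> ?T"
      using summable by (intro sums_Suc_imp_tendsto_sum_from_1 summable_sums)
    ultimately show "(\<lambda>R. (\<Sum>n=1..N. (\<Sum>r=1..R. F r * ramanujan_sum r n) *
        (\<Sum>s=1..R. G s * ramanujan_sum s (n + h))) -
        of_nat N * (\<Sum>r=1..R. F r * G r * ramanujan_sum r h)) \<longlonglongrightarrow>
        (\<Sum>n=1..N. f n * g (n + h)) - of_nat N * ?T"
      by (intro tendsto_intros) auto
    show "\<forall>\<^sub>F R in sequentially. norm ((\<Sum>n=1..N. (\<Sum>r=1..R. F r * ramanujan_sum r n) *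
        (\<Sum>s=1..R. G s * ramanujan_sum s (n + h))) -
        of_nat N * (\<Sum>r=1..R. F r * G r * ramanujan_sum r h)) \<le> K * real N powr (2 / (1 + 2 * \<delta>))"
      unfolding K_def \<theta>(4)[symmetric] using that \<theta> F G assms(6)
      by (intro always_eventually allI norm_sum_ramanujan_partial_products_le) auto
  qed simp
  have K: "K \<ge> 0"
    using coeff_bound_nonneg[OF F] coeff_bound_nonneg[OF G] by (simp add: K_def)
  show "(\<lambda>N::nat. (\<Sum>n=1..N. f n * g (n + h)) - of_nat N * ?T)
      \<in> O[at_top](\<lambda>N. complex_of_real
          (real N powr (2 / (1 + 2 * \<delta>)) * ln (real N) powr ((5 + 2 * \<delta>) / (1 + 2 * \<delta>))))"
  proof (rule bigoI)
    show "\<forall>\<^sub>F N in at_top. norm ((\<Sum>n=1..N. f n * g (n + h)) - of_nat N * ?T) \<le>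
      K * norm (complex_of_real
          (real N powr (2 / (1 + 2 * \<delta>)) * ln (real N) powr ((5 + 2 * \<delta>) / (1 + 2 * \<delta>))))"
      using eventually_ge_at_top[of "3 :: nat"]
    proof eventually_elim
      case (elim N)
      \<comment> \<open>From N = 3 on the logarithm is at least 1, so its positive power may be
        inserted as a factor.\<close>
      have "exp 1 \<le> (3 :: real)" by (rule exp_le)
      with elim have "1 \<le> ln (real N)" by (subst ln_ge_iff) auto
      hence log: "1 \<le> ln (real N) powr ((5 + 2 * \<delta>) / (1 + 2 * \<delta>))"
        using assms(3) by (intro ge_one_powr_ge_zero) auto
      have "K * real N powr (2 / (1 + 2 * \<delta>)) * 1 \<le> K * real N powr (2 / (1 + 2 * \<delta>)) *
          ln (real N) powr ((5 + 2 * \<delta>) / (1 + 2 * \<delta>))"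
        using log K by (intro mult_left_mono) auto
      with bound[of N] elim show ?case
        by (simp add: norm_mult abs_mult mult_ac)
    qed
  qed
qed

end
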